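(* For $b\in\mathbb R$ let $\mathcal S_b(\theta_1,\theta_2)=\sin\theta_1+b\sin\theta_2$ on $\mathbb T^2$, $\Sigma_b=\{\theta\in\mathbb T^2:\mathcal S_b(\theta)=0\}$, $\omega=(1,\sqrt2)$ and $D_\omega=\partial_{\theta_1}+\sqrt2\,\partial_{\theta_2}$. Assume $|b|\notin\{0,1\}$. Then $\Sigma_b$ is a smooth compact curve in $\mathbb T^2$. Moreover: 1. if $0<|b|<\frac1{\sqrt2}$ or $|b|>1$, then $\Sigma_b$ is everywhere transverse to the Kronecker flow of direction $\omega$, i.e. $D_\omega\mathcal S_b\neq0$ on $\Sigma_b$; 2. if $\frac1{\sqrt2}<|b|<1$, the tangencies are of order two; 3. if $|b|=\frac1{\sqrt2}$, the tangencies are of order three.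
   Context: $\mathbb T^2=\mathbb R^2/(2\pi\mathbb Z)^2$. A tangency is a point $\theta_*\in\Sigma_b$ with $D_\omega\mathcal S_b(\theta_* )=0$; it is of order $r\ge2$ if $D_\omega^\ell\mathcal S_b(\theta_* )=0$ for $1\le\ell<r$ and $D_\omega^r\mathcal S_b(\theta_* )\ne0$. *)

theory Defs
  imports "HOL-Analysis.Analysis"
begin

subsection \<open>The torus \<open>\<real>\<^sup>2 / (2\<pi>\<int>)\<^sup>2\<close>\<close>

definition torus_rel :: "real \<times> real \<Rightarrow> real \<times> real \<Rightarrow> bool" where
  "torus_rel x y \<longleftrightarrow>
     (\<exists>m n :: int. x - y = (2 * pi * of_int m, 2 * pi * of_int n))"

lemma equivp_torus_rel: "equivp torus_rel"
proof (rule equivpI)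
  show "reflp torus_rel"
    by (rule reflpI) (auto simp: torus_rel_def zero_prod_def intro!: exI[of _ 0])
  show "symp torus_rel"
  proof (rule sympI)
    fix x y assume "torus_rel x y"
    then obtain m n :: int where "x - y = (2 * pi * of_int m, 2 * pi * of_int n)"
      unfolding torus_rel_def by blast
    then have "y - x = (2 * pi * of_int (- m), 2 * pi * of_int (- n))"
      by (simp add: prod_eq_iff)
    then show "torus_rel y x" unfolding torus_rel_def by blast
  qed
  show "transp torus_rel"
  proof (rule transpI)
    fix x y z assume "torus_rel x y" "torus_rel y z"
    then obtain m n m' n' :: int where
      "x - y = (2 * pi * of_int m, 2 * pi * of_int n)"
      "y - z = (2 * pi * of_int m', 2 * pi * of_int n')"
      unfolding torus_rel_def by blast
    moreover have "x - z = (x - y) + (y - z)" by simp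
    ultimately have "x - z = (2 * pi * of_int (m + m'), 2 * pi * of_int (n + n'))"
      by (simp add: algebra_simps)
    then show "torus_rel x z" unfolding torus_rel_def by blast
  qed
qed

quotient_type torus = "real \<times> real" / torus_rel
  by (rule equivp_torus_rel)

lift_definition torus_proj :: "real \<times> real \<Rightarrow> torus" is "\<lambda>x. x" .

instantiation torus :: topological_space
begin

definition open_torus :: "torus set \<Rightarrow> bool" where
  "open_torus U \<longleftrightarrow> open (torus_proj -` U)"

instance
proof
  show "open (UNIV :: torus set)" by (simp add: open_torus_def)
next
  fix U V :: "torus set" assume "open U" "open V"
  then show "open (U \<inter> V)" by (simp add: open_torus_def vimage_Int open_Int)
next
  fix K :: "torus set set" assume "\<forall>U\<in>K. open U"
  then show "open (\<Union>K)" by (auto simp: open_torus_def vimage_Union)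
qed

end

lift_definition translate :: "torus \<Rightarrow> real \<times> real \<Rightarrow> torus" is "\<lambda>x v. x + v"
  by (simp add: torus_rel_def)

subsection \<open>Smooth embedded curves in the torus\<close>

primrec C_k_on ::
  "nat \<Rightarrow> 'a :: real_normed_vector set \<Rightarrow> ('a \<Rightarrow> 'b :: real_normed_vector) \<Rightarrow> bool" where
  "C_k_on 0 V f \<longleftrightarrow> continuous_on V f"
| "C_k_on (Suc k) V f \<longleftrightarrow>
     (\<forall>x\<in>V. f differentiable (at x)) \<and>
     (\<forall>v. C_k_on k V (\<lambda>x. frechet_derivative f (at x) v))"

text \<open>Only meant for open \<open>V\<close> in a finite-dimensional space.\<close>
definition smooth_on ::
  "'a :: euclidean_space set \<Rightarrow> ('a \<Rightarrow> 'b :: real_normed_vector) \<Rightarrow> bool" where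
  "smooth_on V f \<longleftrightarrow> (\<forall>k. C_k_on k V f)"

definition diffeo_on_image :: "('a :: euclidean_space \<Rightarrow> 'a) \<Rightarrow> 'a set \<Rightarrow> bool" where
  "diffeo_on_image \<phi> V \<longleftrightarrow>
     open V \<and> open (\<phi> ` V) \<and> inj_on \<phi> V \<and>
     smooth_on V \<phi> \<and> smooth_on (\<phi> ` V) (inv_into V \<phi>)"

text \<open>
  A one-dimensional embedded submanifold, given by slice charts.  The smooth structure of the
  torus has as charts the inverses of the projection on open sets where the projection is
  injective; composing such a chart with a diffeomorphism \<open>\<phi>\<close> gives a general chart, in which
  the curve has to become a piece of the first coordinate axis.  Curves need not be connected.
\<close>
definition smooth_curve :: "torus set \<Rightarrow> bool" where
  "smooth_curve C \<longleftrightarrow>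
     (\<forall>p\<in>C. \<exists>V \<phi>. p \<in> torus_proj ` V \<and> inj_on torus_proj V \<and> diffeo_on_image \<phi> V \<and>
        \<phi> ` (V \<inter> torus_proj -` C) = \<phi> ` V \<inter> {y. snd y = 0})"

subsection \<open>Directional derivatives on the torus\<close>

definition partial1 :: "(torus \<Rightarrow> real) \<Rightarrow> torus \<Rightarrow> real" where
  "partial1 f \<theta> = deriv (\<lambda>t. f (translate \<theta> (t, 0))) 0"

definition partial2 :: "(torus \<Rightarrow> real) \<Rightarrow> torus \<Rightarrow> real" where
  "partial2 f \<theta> = deriv (\<lambda>t. f (translate \<theta> (0, t))) 0"

definition omega :: "real \<times> real" where
  "omega = (1, sqrt 2)"

definition D_omega :: "(torus \<Rightarrow> real) \<Rightarrow> torus \<Rightarrow> real" where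
  "D_omega f \<theta> = fst omega * partial1 f \<theta> + snd omega * partial2 f \<theta>"

subsection \<open>The curve and its tangencies\<close>

lift_definition S_fun :: "real \<Rightarrow> torus \<Rightarrow> real" is
  "\<lambda>b (\<theta>1, \<theta>2). sin \<theta>1 + b * sin \<theta>2"
proof -
  fix b :: real and x y :: "real \<times> real"
  assume "torus_rel x y"
  then obtain m n :: int where
    mn: "x - y = (2 * pi * of_int m, 2 * pi * of_int n)"
    unfolding torus_rel_def by blast
  then have "fst x = fst y + 2 * pi * of_int m" "snd x = snd y + 2 * pi * of_int n"
    by (auto simp: prod_eq_iff)
  then have "sin (fst x) = sin (fst y)" "sin (snd x) = sin (snd y)"
    by (simp_all add: sin_add)
  then show "(case x of (\<theta>1, \<theta>2) \<Rightarrow> sin \<theta>1 + b * sin \<theta>2) =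
             (case y of (\<theta>1, \<theta>2) \<Rightarrow> sin \<theta>1 + b * sin \<theta>2)"
    by (simp add: case_prod_beta)
qed

definition Sigma_curve :: "real \<Rightarrow> torus set" where
  "Sigma_curve b = {\<theta>. S_fun b \<theta> = 0}"

definition tangency :: "real \<Rightarrow> torus \<Rightarrow> bool" where
  "tangency b \<theta> \<longleftrightarrow> \<theta> \<in> Sigma_curve b \<and> D_omega (S_fun b) \<theta> = 0"

definition tangency_of_order :: "real \<Rightarrow> nat \<Rightarrow> torus \<Rightarrow> bool" where
  "tangency_of_order b r \<theta> \<longleftrightarrow>
     tangency b \<theta> \<and> r \<ge> 2 \<and>
     (\<forall>l. 1 \<le> l \<and> l < r \<longrightarrow> (D_omega ^^ l) (S_fun b) \<theta> = 0) \<and>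
     (D_omega ^^ r) (S_fun b) \<theta> \<noteq> 0"

end

(*
  At a point of the curve with sin x = - b sin y, the equation cos x + sqrt 2 b cos y = 0 of a
  tangency gives 1 = b^2 (1 + cos^2 y), which is solvable iff 1/2 <= b^2 <= 1.  On the curve the
  second derivative is - b sin y, which at a tangency vanishes iff b^2 = 1/2; in that case the
  third derivative is - sqrt 2 b cos y with cos^2 y = 1.

  Since |b| is neither 0 nor 1, the gradient (cos x, b cos y) does not vanish on the curve, so
  near each of its points the curve is the graph of an explicit branch of arcsin of a multiple of
  sin, over one of the two coordinates; shearing along that graph straightens the curve.
*)
theory Submission
  imports Defs
begin

subsection \<open>Smoothness\<close>

text \<open>On an open set, agreement of two maps passes to their derivatives. Induction therefore
  applies to the directional derivatives, and explicit formulas may replace derivatives and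
  inverses.\<close>

lemma C_k_on_cong:
  assumes "open V" and "\<And>x. x \<in> V \<Longrightarrow> f x = g x" and "C_k_on k V f"
  shows "C_k_on k V g"
  using assms(2,3)
proof (induction k arbitrary: f g)
  case 0
  then show ?case using continuous_on_cong[of V V f g] by simp
next
  case (Suc k)
  have D: "(g has_derivative f') (at x)" if "x \<in> V" "(f has_derivative f') (at x)" for x f'
    using has_derivative_transform_within_open[OF that(2) assms(1) that(1)] Suc.prems(1) by blast
  have fr: "frechet_derivative f (at x) = frechet_derivative g (at x)" if "x \<in> V" for x
    using D[OF that] Suc.prems(2) that frechet_derivative_at frechet_derivative_works
    by (metis C_k_on.simps(2))
  have "g differentiable (at x)" if "x \<in> V" for x
    using D[OF that] Suc.prems(2) that unfolding C_k_on.simps differentiable_def by blast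
  moreover have "C_k_on k V (\<lambda>x. frechet_derivative g (at x) v)" for v
    by (rule Suc.IH[of "\<lambda>x. frechet_derivative f (at x) v"]) (use fr Suc.prems(2) in auto)
  ultimately show ?case by simp
qed

text \<open>The affine part keeps the class of maps closed under differentiation.\<close>
lemma smooth_on_affine_plus_ridge:
  fixes A :: "'a::euclidean_space \<Rightarrow> 'b::real_normed_vector" and l :: "'a \<Rightarrow> real"
    and F :: "(real \<Rightarrow> real) set"
  assumes "open V" and l: "bounded_linear l" and "bounded_linear A" and lV: "l ` V \<subseteq> I"
    and F: "\<And>f. f \<in> F \<Longrightarrow> \<exists>f'\<in>F. \<forall>t\<in>I. (f has_real_derivative f' t) (at t)"
    and "f \<in> F"
  shows "smooth_on V (\<lambda>z. c + A z + f (l z) *\<^sub>R w)"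
  unfolding smooth_on_def
proof
  fix k
  show "C_k_on k V (\<lambda>z. c + A z + f (l z) *\<^sub>R w)"
    using \<open>bounded_linear A\<close> \<open>f \<in> F\<close>
  proof (induction k arbitrary: c A f w)
    case (0 c A f w)
    from F[OF 0(2)] obtain f' where f': "\<And>t. t \<in> I \<Longrightarrow> (f has_real_derivative f' t) (at t)"
      by blast
    then have "continuous_on I f"
      by (meson DERIV_isCont continuous_at_imp_continuous_on)
    then have "continuous_on V (\<lambda>z. f (l z))"
      using continuous_on_compose2[of I f V l] l lV by (simp add: linear_continuous_on)
    then show ?case
      using linear_continuous_on[OF 0(1)] by (auto intro!: continuous_intros)
  next
    case (Suc k)
    from F[OF Suc.prems(2)] obtain f' where "f' \<in> F"
      and f': "\<And>t. t \<in> I \<Longrightarrow> (f has_real_derivative f' t) (at t)"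
      by blast
    have D: "((\<lambda>z. c + A z + f (l z) *\<^sub>R w) has_derivative
        (\<lambda>v. A v + (f' (l z) * l v) *\<^sub>R w)) (at z)" if "z \<in> V" for z
    proof -
      have "l z \<in> I" using lV that by blast
      from has_derivative_compose[OF bounded_linear_imp_has_derivative[OF l]
          f'[OF this, unfolded has_field_derivative_def]]
      have fl: "((\<lambda>z. f (l z)) has_derivative (\<lambda>v. f' (l z) * l v)) (at z)" .
      show ?thesis
        using bounded_linear_imp_has_derivative[OF Suc.prems(1)] fl
        by (auto intro!: derivative_eq_intros)
    qed
    show ?case
      unfolding C_k_on.simps
    proof (intro conjI ballI allI)
      fix z assume "z \<in> V"
      then show "(\<lambda>z. c + A z + f (l z) *\<^sub>R w) differentiable (at z)"
        using D by (auto simp: differentiable_def)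
    next
      fix v
      \<comment> \<open>A directional derivative has the same shape again: constant part
        \<open>A v\<close>, linear part zero, profile \<open>f'\<close> and direction rescaled by
        \<open>l v\<close>. This is why the induction generalizes over \<open>c\<close>,
        \<open>A\<close>, \<open>f\<close> and \<open>w\<close>.\<close>
      have "C_k_on k V (\<lambda>z. A v + 0 + f' (l z) *\<^sub>R (l v *\<^sub>R w))"
        by (rule Suc.IH[of "\<lambda>_. 0"]) (use \<open>f' \<in> F\<close> in auto)
      then show "C_k_on k V (\<lambda>x. frechet_derivative (\<lambda>z. c + A z + f (l z) *\<^sub>R w) (at x) v)"
        by (rule C_k_on_cong[OF \<open>open V\<close>, rotated])
          (simp add: frechet_derivative_at[OF D, symmetric])
    qed
  qed
qed

text \<open>
  The inverse square root is needed for the derivative of the arcsine, and its own derivative is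
  \<open>sin t cos t / \<beta>\<^sup>2\<close> times its cube; this makes the algebra closed under differentiation.
\<close>
inductive_set arcsin_sin_algebra :: "real \<Rightarrow> (real \<Rightarrow> real) set" for \<beta> where
  const: "(\<lambda>_. c) \<in> arcsin_sin_algebra \<beta>"
| sin: "sin \<in> arcsin_sin_algebra \<beta>"
| cos: "cos \<in> arcsin_sin_algebra \<beta>"
| arcsin: "(\<lambda>t. arcsin (sin t / \<beta>)) \<in> arcsin_sin_algebra \<beta>"
| inv_sqrt: "(\<lambda>t. inverse (sqrt (1 - (sin t / \<beta>)\<^sup>2))) \<in> arcsin_sin_algebra \<beta>"
| add: "f \<in> arcsin_sin_algebra \<beta> \<Longrightarrow> g \<in> arcsin_sin_algebra \<beta> \<Longrightarrow>
    (\<lambda>t. f t + g t) \<in> arcsin_sin_algebra \<beta>"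
| mult: "f \<in> arcsin_sin_algebra \<beta> \<Longrightarrow> g \<in> arcsin_sin_algebra \<beta> \<Longrightarrow>
    (\<lambda>t. f t * g t) \<in> arcsin_sin_algebra \<beta>"

text \<open>Where \<open>sin t / \<beta>\<close> is strictly inside the unit interval, arcsine and
  inverse root are differentiable; sums and products follow by linearity and the Leibniz rule. This
  supplies the hypothesis on \<open>F\<close> in \<open>smooth_on_affine_plus_ridge\<close>.\<close>

lemma arcsin_sin_algebra_deriv:
  assumes "\<beta> \<noteq> 0" and "f \<in> arcsin_sin_algebra \<beta>"
  shows "\<exists>f'\<in>arcsin_sin_algebra \<beta>. \<forall>t\<in>{t. \<bar>sin t\<bar> < \<bar>\<beta>\<bar>}. (f has_real_derivative f' t) (at t)"
  using assms(2)
proof induction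
  case (const c)
  show ?case
    by (rule bexI[OF _ arcsin_sin_algebra.const[of 0]]) auto
next
  case sin
  show ?case
    by (rule bexI[OF _ arcsin_sin_algebra.cos]) (auto intro: DERIV_sin)
next
  case cos
  show ?case
    by (rule bexI[OF _ arcsin_sin_algebra.mult[OF arcsin_sin_algebra.const[of "-1"]
            arcsin_sin_algebra.sin]]) (auto intro!: derivative_eq_intros)
next
  case arcsin
  have "((\<lambda>t. arcsin (sin t / \<beta>)) has_real_derivative
      1 / \<beta> * (cos t * inverse (sqrt (1 - (sin t / \<beta>)\<^sup>2)))) (at t)" if "\<bar>sin t\<bar> < \<bar>\<beta>\<bar>" for t
  proof -
    have "\<bar>sin t / \<beta>\<bar> < 1" using that assms(1) by (simp add: abs_divide)
    then have "- 1 < sin t / \<beta>" "sin t / \<beta> < 1" by linarith+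
    then show ?thesis
      by (auto intro!: derivative_eq_intros simp: assms(1))
  qed
  then show ?case
    by (intro bexI[OF _ arcsin_sin_algebra.mult[OF arcsin_sin_algebra.const[of "1 / \<beta>"]
            arcsin_sin_algebra.mult[OF arcsin_sin_algebra.cos arcsin_sin_algebra.inv_sqrt]]]) auto
next
  case inv_sqrt
  let ?s = "\<lambda>t. inverse (sqrt (1 - (sin t / \<beta>)\<^sup>2))"
  have "(?s has_real_derivative
      1 / \<beta>\<^sup>2 * (sin t * (cos t * (?s t * (?s t * ?s t))))) (at t)" if "\<bar>sin t\<bar> < \<bar>\<beta>\<bar>" for t
  proof -
    have "\<bar>sin t / \<beta>\<bar> < 1" using that assms(1) by (simp add: abs_divide)
    then have pos: "0 < 1 - (sin t / \<beta>)\<^sup>2" by (simp add: abs_square_less_1)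
    have D: "((\<lambda>t. 1 - (sin t / \<beta>)\<^sup>2) has_real_derivative - (2 * (sin t / \<beta>) * (cos t / \<beta>))) (at t)"
      by (auto intro!: derivative_eq_intros simp: assms(1))
    have "(?s has_real_derivative
        - (?s t * (?s t / 2 * - (2 * (sin t / \<beta>) * (cos t / \<beta>))) * ?s t)) (at t)"
      by (rule DERIV_inverse'[OF DERIV_chain2[OF DERIV_real_sqrt[OF pos] D]]) (use pos in simp)
    \<comment> \<open>With root, sine and cosine replaced by free variables, only field arithmetic
      remains.\<close>
    moreover have "- (q * (q / 2 * - (2 * (S / \<beta>) * (C / \<beta>))) * q) =
        1 / \<beta>\<^sup>2 * (S * (C * (q * (q * q))))" for q S C
      by (simp add: power2_eq_square)
    ultimately show ?thesis by (simp only:)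
  qed
  then show ?case
    by (intro bexI[OF _ arcsin_sin_algebra.mult[OF arcsin_sin_algebra.const[of "1 / \<beta>\<^sup>2"]
            arcsin_sin_algebra.mult[OF arcsin_sin_algebra.sin
              arcsin_sin_algebra.mult[OF arcsin_sin_algebra.cos
                arcsin_sin_algebra.mult[OF arcsin_sin_algebra.inv_sqrt
                  arcsin_sin_algebra.mult[OF arcsin_sin_algebra.inv_sqrt
                    arcsin_sin_algebra.inv_sqrt]]]]]]) auto
next
  case (add f g)
  then obtain f' g' where "f' \<in> arcsin_sin_algebra \<beta>" "g' \<in> arcsin_sin_algebra \<beta>"
    and "\<forall>t\<in>{t. \<bar>sin t\<bar> < \<bar>\<beta>\<bar>}. (f has_real_derivative f' t) (at t)"
    and "\<forall>t\<in>{t. \<bar>sin t\<bar> < \<bar>\<beta>\<bar>}. (g has_real_derivative g' t) (at t)"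
    by blast
  then show ?case
    by (intro bexI[of _ "\<lambda>t. f' t + g' t"])
      (auto intro: DERIV_add arcsin_sin_algebra.add)
next
  case (mult f g)
  then obtain f' g' where "f' \<in> arcsin_sin_algebra \<beta>" "g' \<in> arcsin_sin_algebra \<beta>"
    and "\<forall>t\<in>{t. \<bar>sin t\<bar> < \<bar>\<beta>\<bar>}. (f has_real_derivative f' t) (at t)"
    and "\<forall>t\<in>{t. \<bar>sin t\<bar> < \<bar>\<beta>\<bar>}. (g has_real_derivative g' t) (at t)"
    by blast
  with mult.hyps show ?case
    by (intro bexI[of _ "\<lambda>t. f' t * g t + g' t * f t"])
      (auto intro!: DERIV_mult arcsin_sin_algebra.intros)
qed

subsection \<open>Charts of the curve\<close>

text \<open>
  The map \<open>\<rho>\<close> is the identity or the swap of the coordinates; the curve \<open>w = h u\<close> is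
  straightened in the coordinates \<open>(u, w) = \<rho> z\<close>.
\<close>
lemma diffeo_on_image_shear:
  fixes \<rho> :: "real \<times> real \<Rightarrow> real \<times> real"
  assumes \<rho>: "bounded_linear \<rho>" "\<And>z. \<rho> (\<rho> z) = z"
    and U: "open U" "U \<subseteq> I" and W: "open W"
    and F: "\<And>f. f \<in> F \<Longrightarrow> \<exists>f'\<in>F. \<forall>t\<in>I. (f has_real_derivative f' t) (at t)"
    and h: "h \<in> F"
  shows "diffeo_on_image (\<lambda>z. \<rho> z - (0, h (fst (\<rho> z)))) (\<rho> -` (U \<times> W))"
proof -
  let ?\<phi> = "\<lambda>z. \<rho> z - (0, h (fst (\<rho> z)))"
  let ?\<psi> = "\<lambda>y. \<rho> (y + (0, h (fst y)))"
  let ?V = "\<rho> -` (U \<times> W)"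
  have cont_\<rho>: "continuous_on S \<rho>" for S
    using \<rho>(1) by (rule linear_continuous_on)
  have inv: "?\<psi> (?\<phi> z) = z" "?\<phi> (?\<psi> y) = y" for z y
    by (simp_all add: \<rho>(2))
  \<comment> \<open>Describing the image as a preimage under the explicit inverse reduces its
    openness to continuity of that inverse.\<close>
  have image: "?\<phi> ` ?V = (U \<times> UNIV) \<inter> ?\<psi> -` ?V"
  proof
    show "?\<phi> ` ?V \<subseteq> (U \<times> UNIV) \<inter> ?\<psi> -` ?V"
      by (auto simp: \<rho>(2) mem_Times_iff)
    show "(U \<times> UNIV) \<inter> ?\<psi> -` ?V \<subseteq> ?\<phi> ` ?V"
    proof
      fix y assume "y \<in> (U \<times> UNIV) \<inter> ?\<psi> -` ?V"
      then have "?\<psi> y \<in> ?V" by simp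
      then have "?\<phi> (?\<psi> y) \<in> ?\<phi> ` ?V" by (rule imageI)
      then show "y \<in> ?\<phi> ` ?V" by (simp only: inv)
    qed
  qed
  have V: "open ?V"
    by (rule open_vimage) (use U W cont_\<rho> in \<open>auto intro: open_Times\<close>)
  \<comment> \<open>Stated for any open \<open>X\<close> because it is used twice: on
    \<open>U \<times> UNIV\<close>, to show that the image is open, and then on the image
    itself.\<close>
  have smooth_\<psi>: "smooth_on X ?\<psi>" if "open X" "fst ` X \<subseteq> I" for X
  proof -
    have "?\<psi> y = 0 + \<rho> y + h (fst y) *\<^sub>R \<rho> (0, 1)" for y
    proof -
      have "(0, h (fst y)) = h (fst y) *\<^sub>R (0::real, 1::real)" by simp
      then show ?thesis
        using linear_add[of \<rho>] linear_scale[of \<rho>] \<rho>(1) by (metis add_0 bounded_linear.linear)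
    qed
    then show ?thesis
      using smooth_on_affine_plus_ridge[OF that(1) bounded_linear_fst \<rho>(1) that(2) F h, of 0 "\<rho> (0,1)"]
      by simp
  qed
  have sU: "fst ` (U \<times> (UNIV :: real set)) \<subseteq> I" "open (U \<times> (UNIV :: real set))"
    using U by (auto intro: open_Times)
  have "continuous_on (U \<times> UNIV) ?\<psi>"
    using smooth_\<psi>[OF sU(2,1)] by (auto simp: smooth_on_def dest: spec[of _ 0])
  then have im_open: "open (?\<phi> ` ?V)"
    unfolding image using continuous_open_preimage[OF _ sU(2) V] by blast
  have "smooth_on ?V (\<lambda>z. 0 + \<rho> z + h ((fst \<circ> \<rho>) z) *\<^sub>R (0, - 1))"
    by (rule smooth_on_affine_plus_ridge[OF V _ \<rho>(1) _ F h])
      (use U \<rho>(1) bounded_linear_compose[OF bounded_linear_fst] in \<open>auto simp: o_def mem_Times_iff\<close>)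
  moreover have "(\<lambda>z. 0 + \<rho> z + h ((fst \<circ> \<rho>) z) *\<^sub>R (0, - 1)) = ?\<phi>"
    by (simp add: fun_eq_iff prod_eq_iff)
  ultimately have smooth_\<phi>: "smooth_on ?V ?\<phi>" by (simp only:)
  have inj: "inj_on ?\<phi> ?V"
    by (rule inj_on_inverseI[of _ ?\<psi>]) (rule inv)
  \<comment> \<open>The inverse given by \<open>inv_into\<close> agrees with \<open>?\<psi>\<close>
    only on the image, so smoothness is transferred there by congruence.\<close>
  have "C_k_on k (?\<phi> ` ?V) (inv_into ?V ?\<phi>)" for k
  proof (rule C_k_on_cong[OF im_open])
    show "C_k_on k (?\<phi> ` ?V) ?\<psi>"
    proof -
      have "fst ` ?\<phi> ` ?V \<subseteq> I" using U(2) unfolding image by auto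
      then show ?thesis using smooth_\<psi>[OF im_open] unfolding smooth_on_def by blast
    qed
    fix y assume "y \<in> ?\<phi> ` ?V"
    then obtain z where z: "z \<in> ?V" "y = ?\<phi> z" by blast
    show "?\<psi> y = inv_into ?V ?\<phi> y"
      unfolding z(2) inv(1) using inv_into_f_f[OF inj z(1)] by simp
  qed
  then show ?thesis
    using V im_open inj smooth_\<phi> unfolding diffeo_on_image_def smooth_on_def by blast
qed

section \<open>Representatives of points of the torus\<close>

lemma torus_proj_eq_iff: "torus_proj x = torus_proj y \<longleftrightarrow> torus_rel x y"
  by transfer simp

lemma torus_cases:
  obtains x y where "\<theta> = torus_proj (x, y)"
  by transfer (metis surj_pair equivp_reflp equivp_torus_rel)

text \<open>Representatives of one point differ by whole periods, and a whole period smaller than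
  \<open>2 * pi\<close> in modulus is zero.\<close>

lemma inj_on_torus_proj:
  assumes "\<And>x y. x \<in> V \<Longrightarrow> y \<in> V \<Longrightarrow> \<bar>fst x - fst y\<bar> < 2 * pi \<and> \<bar>snd x - snd y\<bar> < 2 * pi"
  shows "inj_on torus_proj V"
proof (rule inj_onI)
  fix x y assume xy: "x \<in> V" "y \<in> V" "torus_proj x = torus_proj y"
  then obtain m n :: int where mn: "x - y = (2 * pi * of_int m, 2 * pi * of_int n)"
    by (auto simp: torus_proj_eq_iff torus_rel_def)
  have *: "k = 0" if "\<bar>2 * pi * of_int k\<bar> < 2 * pi" for k :: int
  proof -
    have "2 * pi * \<bar>of_int k\<bar> < 2 * pi * 1" using that by (simp add: abs_mult)
    then have "\<bar>of_int k :: real\<bar> < 1" by (subst (asm) mult_less_cancel_left_pos) auto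
    then show ?thesis by linarith
  qed
  have "\<bar>2 * pi * of_int m\<bar> < 2 * pi" "\<bar>2 * pi * of_int n\<bar> < 2 * pi"
    using assms[OF xy(1,2)] mn by (auto simp: prod_eq_iff)
  then have "m = 0" "n = 0" by (auto dest: *)
  with mn show "x = y" by (simp add: prod_eq_iff)
qed

lemma S_fun_proj: "S_fun b (torus_proj (x, y)) = sin x + b * sin y"
  by transfer simp

lemma proj_in_Sigma_curve_iff:
  "torus_proj z \<in> Sigma_curve b \<longleftrightarrow> sin (fst z) + b * sin (snd z) = 0"
  by (cases z) (simp add: Sigma_curve_def S_fun_proj)

text \<open>The cosine condition allows solving for the second coordinate of
  \<open>\<rho> z\<close>. The choice of \<open>\<rho>\<close> decides which original coordinate
  that is, so one argument covers graphs over either axis.\<close>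

lemma Sigma_curve_chart:
  fixes \<rho> :: "real \<times> real \<Rightarrow> real \<times> real"
  assumes \<rho>: "\<rho> = id \<or> \<rho> = prod.swap" and "\<beta> \<noteq> 0"
    and C: "\<And>z. torus_proj z \<in> C \<longleftrightarrow> sin (fst (\<rho> z)) + \<beta> * sin (snd (\<rho> z)) = 0"
    and z: "torus_proj z \<in> C" and cos: "cos (snd (\<rho> z)) \<noteq> 0"
  shows "\<exists>V \<phi>. torus_proj z \<in> torus_proj ` V \<and> inj_on torus_proj V \<and> diffeo_on_image \<phi> V \<and>
        \<phi> ` (V \<inter> torus_proj -` C) = \<phi> ` V \<inter> {y. snd y = 0}"
proof -
  obtain u0 w0 where uw: "\<rho> z = (u0, w0)" by fastforce
  have cw0: "cos w0 \<noteq> 0" using cos uw by simp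
  have \<rho>\<rho>: "\<rho> (\<rho> x) = x" for x using \<rho> by auto
  have "prod.swap = (\<lambda>z :: real \<times> real. (snd z, fst z))"
    by (simp add: fun_eq_iff)
  then have "bounded_linear (prod.swap :: real \<times> real \<Rightarrow> real \<times> real)"
    using bounded_linear_Pair[OF bounded_linear_snd bounded_linear_fst] by metis
  then have \<rho>_bl: "bounded_linear \<rho>"
    using \<rho> by (auto simp: id_def)
  \<comment> \<open>Reducing \<open>w0\<close> modulo \<open>pi\<close> into the open interval from
    \<open>- pi / 2\<close> to \<open>pi / 2\<close> makes \<open>c\<close> the nearest multiple of
    \<open>pi\<close>: hence \<open>sin c = 0\<close> and \<open>cos c\<close> is a sign.\<close>
  define c where "c = w0 - arctan (tan w0)"
  define I where "I = {t. \<bar>sin t\<bar> < \<bar>\<beta>\<bar>}"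
  \<comment> \<open>Since \<open>sin w = cos c * sin (w - c)\<close>, the curve equation reads
    \<open>sin (w - c) = - cos c * (sin u / \<beta>)\<close>. Inverting the sine and pulling the
    sign out of the odd arcsine gives \<open>h\<close>.\<close>
  define h where "h t = c + - cos c * arcsin (sin t / \<beta>)" for t
  \<comment> \<open>The widths 2 of \<open>U\<close> and \<open>pi\<close> of \<open>W\<close> stay
    below the period, which yields injectivity; \<open>I\<close> keeps \<open>h\<close> smooth, and
    on \<open>W\<close> the arcsine inverts the sine of \<open>w - c\<close>.\<close>
  define U where "U = {t. \<bar>t - u0\<bar> < 1} \<inter> I"
  define W where "W = {t. \<bar>t - c\<bar> < pi / 2}"
  define V where "V = \<rho> -` (U \<times> W)"
  define \<phi> where "\<phi> = (\<lambda>z. \<rho> z - (0, h (fst (\<rho> z))))"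
  have "sin c = sin w0 * cos (arctan (tan w0)) - cos w0 * sin (arctan (tan w0))"
    by (simp add: c_def sin_diff)
  moreover have "sin w0 = tan w0 * cos w0" "sin (arctan t) = t * cos (arctan t)" for t
    using cw0 tan_arctan[of t] by (simp_all add: tan_def field_simps)
  ultimately have sc: "sin c = 0" by simp
  then have cc: "cos c * cos c = 1"
    using sin_cos_squared_add[of c] by (simp add: power2_eq_square)
  have "cos c = 1 \<or> cos c = - 1" using cc by (simp add: square_eq_1_iff)
  have w0: "w0 \<in> W"
    using arctan_bounded[of "tan w0"] by (auto simp: W_def c_def abs_less_iff)
  have cos_w0: "\<bar>sin w0\<bar> < 1"
  proof -
    have "0 < (cos w0)\<^sup>2" using cw0 by simp
    then have "(sin w0)\<^sup>2 < 1" using sin_cos_squared_add[of w0] by linarith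
    then show ?thesis by (simp add: abs_square_less_1)
  qed
  \<comment> \<open>Strictness matters: \<open>cos w0 \<noteq> 0\<close> gives modulus of
    \<open>sin w0\<close> below one, so \<open>u0\<close> avoids the endpoints where the arcsine is
    not smooth.\<close>
  have "sin u0 = - (\<beta> * sin w0)"
    using z C uw by (simp add: eq_neg_iff_add_eq_0)
  then have "\<bar>sin u0\<bar> < \<bar>\<beta>\<bar>"
    using cos_w0 \<open>\<beta> \<noteq> 0\<close> by (simp add: abs_mult)
  then have "z \<in> V"
    using w0 by (simp add: V_def U_def I_def uw)
  moreover have "inj_on torus_proj V"
  proof (rule inj_on_torus_proj)
    fix x y assume "x \<in> V" "y \<in> V"
    then have "\<bar>fst (\<rho> x) - u0\<bar> < 1" "\<bar>fst (\<rho> y) - u0\<bar> < 1"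
      "\<bar>snd (\<rho> x) - c\<bar> < pi / 2" "\<bar>snd (\<rho> y) - c\<bar> < pi / 2"
      by (simp_all add: V_def U_def W_def mem_Times_iff)
    then have "\<bar>fst (\<rho> x) - fst (\<rho> y)\<bar> < 2 * pi" "\<bar>snd (\<rho> x) - snd (\<rho> y)\<bar> < 2 * pi"
      using pi_gt3 by linarith+
    then show "\<bar>fst x - fst y\<bar> < 2 * pi \<and> \<bar>snd x - snd y\<bar> < 2 * pi"
      using \<rho> by auto
  qed
  moreover have "diffeo_on_image \<phi> V"
    unfolding \<phi>_def V_def
  proof (rule diffeo_on_image_shear[OF \<rho>_bl \<rho>\<rho>])
    show "open U" unfolding U_def I_def
      by (intro open_Int open_Collect_less continuous_intros)
    show "open W" unfolding W_def by (intro open_Collect_less continuous_intros)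
    show "U \<subseteq> I" by (simp add: U_def)
    show "\<exists>f'\<in>arcsin_sin_algebra \<beta>. \<forall>t\<in>I. (f has_real_derivative f' t) (at t)"
      if "f \<in> arcsin_sin_algebra \<beta>" for f
      using arcsin_sin_algebra_deriv[OF \<open>\<beta> \<noteq> 0\<close> that] by (simp add: I_def)
    show "h \<in> arcsin_sin_algebra \<beta>"
      unfolding h_def by (intro arcsin_sin_algebra.intros)
  qed
  moreover have "\<phi> ` (V \<inter> torus_proj -` C) = \<phi> ` V \<inter> {y. snd y = 0}"
  proof -
    have "torus_proj x \<in> C \<longleftrightarrow> snd (\<phi> x) = 0" if "x \<in> V" for x
    proof -
      obtain u w where x: "\<rho> x = (u, w)" by fastforce
      have u: "\<bar>sin u\<bar> < \<bar>\<beta>\<bar>" and w: "\<bar>w - c\<bar> < pi / 2"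
        using that x by (auto simp: V_def U_def W_def I_def)
      have sw: "sin w = cos c * sin (w - c)"
        using sin_add[of c "w - c"] sc by simp
      have su: "- 1 \<le> sin u / \<beta>" "sin u / \<beta> \<le> 1"
      proof -
        have "\<bar>sin u / \<beta>\<bar> < 1" using u \<open>\<beta> \<noteq> 0\<close> by (simp add: abs_divide)
        then show "- 1 \<le> sin u / \<beta>" "sin u / \<beta> \<le> 1" by linarith+
      qed
      have ar: "arcsin (- cos c * (sin u / \<beta>)) = - cos c * arcsin (sin u / \<beta>)"
        using \<open>cos c = 1 \<or> cos c = - 1\<close> su arcsin_minus[of "sin u / \<beta>"] by auto
      have bd: "- 1 \<le> - cos c * (sin u / \<beta>)" "- cos c * (sin u / \<beta>) \<le> 1"
        using \<open>cos c = 1 \<or> cos c = - 1\<close> su by auto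
      have "torus_proj x \<in> C \<longleftrightarrow> sin u + \<beta> * sin w = 0" using C x by simp
      also have "\<dots> \<longleftrightarrow> sin (w - c) = - cos c * (sin u / \<beta>)"
        unfolding sw using \<open>cos c = 1 \<or> cos c = - 1\<close> \<open>\<beta> \<noteq> 0\<close> by (auto simp: field_simps)
      also have "\<dots> \<longleftrightarrow> w - c = arcsin (- cos c * (sin u / \<beta>))"
      proof -
        have "- (pi / 2) \<le> w - c" "w - c \<le> pi / 2" using w by linarith+
        then show ?thesis using bd arcsin_sin[of "w - c"] sin_arcsin by metis
      qed
      also have "\<dots> \<longleftrightarrow> snd (\<phi> x) = 0"
        unfolding ar by (auto simp: \<phi>_def h_def x)
      finally show ?thesis .
    qed
    then show ?thesis by auto
  qed
  ultimately show ?thesis by blast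
qed

lemma smooth_curve_Sigma_curve:
  assumes "\<bar>b\<bar> \<noteq> 0" "\<bar>b\<bar> \<noteq> 1"
  shows "smooth_curve (Sigma_curve b)"
  unfolding smooth_curve_def
proof
  fix p assume p: "p \<in> Sigma_curve b"
  obtain x y where p_eq: "p = torus_proj (x, y)" by (rule torus_cases)
  have S: "sin x + b * sin y = 0"
    using p by (simp add: p_eq proj_in_Sigma_curve_iff)
  show "\<exists>V \<phi>. p \<in> torus_proj ` V \<and> inj_on torus_proj V \<and> diffeo_on_image \<phi> V \<and>
        \<phi> ` (V \<inter> torus_proj -` Sigma_curve b) = \<phi> ` V \<inter> {y. snd y = 0}"
  proof (cases "cos y = 0")
    case False
    then show ?thesis
      unfolding p_eq using assms p
      by (intro Sigma_curve_chart[of id b]) (auto simp: p_eq proj_in_Sigma_curve_iff)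
  next
    case True
    \<comment> \<open>If both cosines vanished, both sines would have modulus one and the curve
      equation would force modulus one on \<open>b\<close>.\<close>
    have "cos x \<noteq> 0"
    proof
      assume "cos x = 0"
      then have "\<bar>sin x\<bar> = 1" "\<bar>sin y\<bar> = 1"
        using True sin_cos_squared_add[of x] sin_cos_squared_add[of y]
        by (auto simp: power2_eq_1_iff)
      moreover have "\<bar>sin x\<bar> = \<bar>b\<bar> * \<bar>sin y\<bar>"
        using S by (metis abs_minus_cancel abs_mult add.commute add_eq_0_iff)
      ultimately show False using assms by simp
    qed
    \<comment> \<open>Dividing by \<open>b\<close> exchanges the roles of the coordinates, with
      coefficient \<open>1 / b\<close>.\<close>
    moreover have "sin u + b * sin w = 0 \<longleftrightarrow> sin w + 1 / b * sin u = 0" for u w :: real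
      using assms by (auto simp: field_simps add_eq_0_iff)
    ultimately show ?thesis
      unfolding p_eq using assms p
      by (intro Sigma_curve_chart[of prod.swap "1 / b"]) (auto simp: p_eq proj_in_Sigma_curve_iff)
  qed
qed

subsection \<open>Compactness\<close>

lemma continuous_on_torus_proj: "continuous_on S torus_proj"
proof -
  have "continuous_on UNIV torus_proj"
    by (simp add: continuous_on_open_vimage open_torus_def)
  then show ?thesis by (rule continuous_on_subset) simp
qed

text \<open>Each coordinate is reduced modulo \<open>2 * pi\<close> by a floor. The closed square is
  taken for compactness; its doubly covered edges do no harm.\<close>

lemma torus_proj_cbox: "\<exists>z\<in>cbox (0, 0) (2 * pi, 2 * pi). \<theta> = torus_proj z"
proof -
  obtain x y where \<theta>: "\<theta> = torus_proj (x, y)" by (rule torus_cases)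
  define r where "r t = t - 2 * pi * of_int \<lfloor>t / (2 * pi)\<rfloor>" for t :: real
  have r: "0 \<le> r t \<and> r t \<le> 2 * pi" for t
  proof -
    have "r t = 2 * pi * frac (t / (2 * pi))"
      by (simp add: r_def frac_def field_simps)
    then show ?thesis
      using frac_ge_0[of "t / (2 * pi)"] frac_lt_1[of "t / (2 * pi)"]
      by (simp add: mult_le_cancel_left1)
  qed
  have "torus_rel (x, y) (r x, r y)"
    unfolding torus_rel_def r_def by (intro exI) simp
  then show ?thesis
    using r by (intro bexI[of _ "(r x, r y)"]) (auto simp: \<theta> torus_proj_eq_iff cbox_Pair_eq)
qed

text \<open>The quotient topology makes the projection continuous, so the curve is the continuous
  image of a compact part of the plane.\<close>

lemma compact_Sigma_curve: "compact (Sigma_curve b)"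
proof -
  let ?K = "cbox (0, 0) (2 * pi, 2 * pi) \<inter> {z. sin (fst z) + b * sin (snd z) = 0}"
  have "closed {z :: real \<times> real. sin (fst z) + b * sin (snd z) = 0}"
    by (intro closed_Collect_eq continuous_intros)
  then have "compact ?K"
    by (intro compact_Int_closed compact_cbox)
  moreover have "Sigma_curve b = torus_proj ` ?K"
    using torus_proj_cbox proj_in_Sigma_curve_iff by fastforce
  ultimately show ?thesis
    using compact_continuous_image[OF continuous_on_torus_proj] by metis
qed

subsection \<open>Tangencies\<close>

lemma translate_proj: "translate (torus_proj z) v = torus_proj (z + v)"
  by transfer (rule equivp_reflp[OF equivp_torus_rel])

text \<open>The span of the sines and cosines of the two coordinates is invariant under
  \<open>D_omega\<close>, so higher derivatives come from iterating this change of
  coefficients.\<close>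

lemma D_omega_trig:
  assumes "\<And>x y. f (torus_proj (x, y)) = p * sin x + q * cos x + r * sin y + s * cos y"
  shows "D_omega f (torus_proj (x, y)) =
    (- q) * sin x + p * cos x + (- sqrt 2 * s) * sin y + (sqrt 2 * r) * cos y"
proof -
  have "partial1 f (torus_proj (x, y)) = p * cos x - q * sin x"
    unfolding partial1_def translate_proj
    by (rule DERIV_imp_deriv) (auto simp: assms intro!: derivative_eq_intros)
  moreover have "partial2 f (torus_proj (x, y)) = r * cos y - s * sin y"
    unfolding partial2_def translate_proj
    by (rule DERIV_imp_deriv) (auto simp: assms intro!: derivative_eq_intros)
  ultimately show ?thesis
    by (simp add: D_omega_def omega_def right_diff_distrib)
qed

lemma D_omega_S_fun:
  "D_omega (S_fun b) (torus_proj (x, y)) = cos x + sqrt 2 * b * cos y"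
  "D_omega (D_omega (S_fun b)) (torus_proj (x, y)) = - sin x - 2 * b * sin y"
  "D_omega (D_omega (D_omega (S_fun b))) (torus_proj (x, y)) = - cos x - 2 * sqrt 2 * b * cos y"
proof -
  \<comment> \<open>The zero coefficients put \<open>S_fun b\<close> into the shape that
    \<open>D_omega_trig\<close> takes and returns.\<close>
  have 0: "S_fun b (torus_proj (x, y)) = 1 * sin x + 0 * cos x + b * sin y + 0 * cos y" for x y
    by (simp add: S_fun_proj)
  note 1 = D_omega_trig[of "S_fun b", OF 0]
  note 2 = D_omega_trig[of "D_omega (S_fun b)", OF 1]
  note 3 = D_omega_trig[of "D_omega (D_omega (S_fun b))", OF 2]
  show "D_omega (S_fun b) (torus_proj (x, y)) = cos x + sqrt 2 * b * cos y"
    "D_omega (D_omega (S_fun b)) (torus_proj (x, y)) = - sin x - 2 * b * sin y"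
    "D_omega (D_omega (D_omega (S_fun b))) (torus_proj (x, y)) = - cos x - 2 * sqrt 2 * b * cos y"
    by (simp_all add: 1 2 3)
qed

section \<open>Existence of tangencies\<close>

lemma tangency_proj_iff:
  "tangency b (torus_proj (x, y)) \<longleftrightarrow> sin x = - b * sin y \<and> cos x = - sqrt 2 * b * cos y"
  by (auto simp: tangency_def proj_in_Sigma_curve_iff D_omega_S_fun)

text \<open>Squaring and adding the two tangency equations eliminates \<open>x\<close> and leaves a
  condition on \<open>y\<close> alone.\<close>

lemma tangency_imp_cos:
  assumes "tangency b (torus_proj (x, y))"
  shows "b\<^sup>2 * (1 + (cos y)\<^sup>2) = 1"
proof -
  have "b\<^sup>2 * (1 + (cos y)\<^sup>2) = b\<^sup>2 * ((sin y)\<^sup>2 + (cos y)\<^sup>2 + (cos y)\<^sup>2)"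
    by (simp only: sin_cos_squared_add)
  also have "\<dots> = (b * sin y)\<^sup>2 + (sqrt 2 * b * cos y)\<^sup>2"
    by (simp add: power_mult_distrib distrib_left) (simp add: sin_squared_eq algebra_simps)
  also have "\<dots> = 1"
    using assms sin_cos_squared_add[of x] by (simp add: tangency_proj_iff)
  finally show ?thesis .
qed

text \<open>The factor \<open>1 + (cos y)\<^sup>2\<close> lies between 1 and 2. Outside the
  resulting range of \<open>b\<^sup>2\<close> the curve is transverse.\<close>

lemma tangency_imp_bounds:
  assumes "tangency b \<theta>"
  shows "1 / 2 \<le> b\<^sup>2" "b\<^sup>2 \<le> 1"
proof -
  obtain x y where "\<theta> = torus_proj (x, y)" by (rule torus_cases)
  then have eq: "b\<^sup>2 + b\<^sup>2 * (cos y)\<^sup>2 = 1"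
    using tangency_imp_cos assms by (simp add: distrib_left)
  have "b\<^sup>2 * (cos y)\<^sup>2 \<le> b\<^sup>2 * 1"
    by (rule mult_left_mono) (auto simp: abs_square_le_1)
  moreover have "0 \<le> b\<^sup>2 * (cos y)\<^sup>2" by simp
  ultimately show "1 / 2 \<le> b\<^sup>2" "b\<^sup>2 \<le> 1" using eq by linarith+
qed

text \<open>The converse of the bounds; it keeps the claims about orders from being vacuous.\<close>

lemma ex_tangency:
  assumes "1 / 2 \<le> b\<^sup>2" "b\<^sup>2 \<le> 1"
  shows "\<exists>\<theta>. tangency b \<theta>"
proof -
  have b: "b\<^sup>2 > 0" using assms(1) by linarith
  have r: "0 \<le> 1 / b\<^sup>2 - 1" "1 / b\<^sup>2 - 1 \<le> 1"
    using assms b by (simp_all add: field_simps)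
  \<comment> \<open>This solves \<open>b\<^sup>2 * (1 + (cos y)\<^sup>2) = 1\<close>; the bounds on
    \<open>b\<close> put the radicand between 0 and 1.\<close>
  define y where "y = arccos (sqrt (1 / b\<^sup>2 - 1))"
  have "cos y = sqrt (1 / b\<^sup>2 - 1)"
    unfolding y_def using r by (intro cos_arccos) (auto intro: order_trans[of _ 0])
  then have cy: "(cos y)\<^sup>2 = 1 / b\<^sup>2 - 1" using r by simp
  \<comment> \<open>The values prescribed for \<open>cos x\<close> and \<open>sin x\<close> form a
    point of the unit circle, hence some angle \<open>x\<close> realizes them.\<close>
  have "(- sqrt 2 * b * cos y)\<^sup>2 + (- b * sin y)\<^sup>2 = b\<^sup>2 * (2 * (cos y)\<^sup>2 + (sin y)\<^sup>2)"
    by (simp add: power_mult_distrib algebra_simps)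
  also have "\<dots> = b\<^sup>2 * (1 + (cos y)\<^sup>2)"
    using sin_cos_squared_add[of y] by algebra
  also have "\<dots> = 1" using b by (simp add: cy)
  finally obtain x where "- sqrt 2 * b * cos y = cos x" "- b * sin y = sin x"
    using sincos_total_2pi by metis
  then have "tangency b (torus_proj (x, y))" by (simp add: tangency_proj_iff)
  then show ?thesis ..
qed

section \<open>Orders of the tangencies\<close>

lemma tangency_D_omega:
  assumes "tangency b (torus_proj (x, y))"
  shows "(D_omega ^^ 2) (S_fun b) (torus_proj (x, y)) = - b * sin y"
    and "(D_omega ^^ 3) (S_fun b) (torus_proj (x, y)) = - sqrt 2 * b * cos y"
  \<comment> \<open>Each tangency equation cancels half of the \<open>y\<close> term and removes
    \<open>x\<close>.\<close>
  using assms by (simp_all add: eval_nat_numeral D_omega_S_fun tangency_proj_iff)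

text \<open>In terms of the sine, the relation on \<open>y\<close> becomes
  \<open>2 * b\<^sup>2 - b\<^sup>2 * (sin y)\<^sup>2 = 1\<close>. This singles out the value of
  \<open>b\<^sup>2\<close> at which the second derivative vanishes.\<close>

lemma tangency_sin_eq_0_iff:
  assumes "tangency b (torus_proj (x, y))"
  shows "sin y = 0 \<longleftrightarrow> b\<^sup>2 = 1 / 2"
proof -
  have "b\<^sup>2 * (2 - (sin y)\<^sup>2) = 1"
    using tangency_imp_cos[OF assms] by (simp add: cos_squared_eq)
  then show ?thesis by (auto simp: algebra_simps)
qed

lemma tangency_imp_neq_0: "tangency b \<theta> \<Longrightarrow> b \<noteq> 0"
  using tangency_imp_bounds(1) by force

lemma tangency_order_two:
  assumes "tangency b \<theta>" and "b\<^sup>2 \<noteq> 1 / 2"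
  shows "tangency_of_order b 2 \<theta>"
proof -
  obtain x y where \<theta>: "\<theta> = torus_proj (x, y)" by (rule torus_cases)
  have "(D_omega ^^ l) (S_fun b) \<theta> = 0" if "1 \<le> l" "l < 2" for l
  proof -
    have "l = 1" using that by simp
    then show ?thesis using assms(1) by (simp add: tangency_def)
  qed
  moreover have "(D_omega ^^ 2) (S_fun b) \<theta> \<noteq> 0"
    using assms tangency_sin_eq_0_iff tangency_imp_neq_0 by (simp add: \<theta> tangency_D_omega(1))
  ultimately show ?thesis
    using assms(1) by (simp add: tangency_of_order_def)
qed

text \<open>Here \<open>sin y = 0\<close> kills the second derivative, while \<open>cos y\<close>,
  then of modulus one, keeps the third nonzero.\<close>

lemma tangency_order_three:
  assumes "tangency b \<theta>" and "b\<^sup>2 = 1 / 2"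
  shows "tangency_of_order b 3 \<theta>"
proof -
  obtain x y where \<theta>: "\<theta> = torus_proj (x, y)" by (rule torus_cases)
  have sy: "sin y = 0"
    using assms tangency_sin_eq_0_iff by (simp add: \<theta>)
  then have "cos y \<noteq> 0" using sin_zero_abs_cos_one by fastforce
  then have "(D_omega ^^ 3) (S_fun b) \<theta> \<noteq> 0"
    using assms tangency_imp_neq_0 by (simp add: \<theta> tangency_D_omega(2))
  moreover have "(D_omega ^^ l) (S_fun b) \<theta> = 0" if "1 \<le> l" "l < 3" for l
  proof -
    have "l = 1 \<or> l = 2" using that by auto
    then show ?thesis
    proof
      assume "l = 1"
      then show ?thesis using assms(1) by (simp add: tangency_def)
    next
      assume "l = 2"
      then show ?thesis using assms(1) sy by (simp only: \<theta> tangency_D_omega(1))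
    qed
  qed
  ultimately show ?thesis
    using assms(1) by (simp add: tangency_of_order_def)
qed

lemma abs_compare_inv_sqrt_2:
  fixes b :: real
  shows "\<bar>b\<bar> < 1 / sqrt 2 \<longleftrightarrow> b\<^sup>2 < 1 / 2" "1 / sqrt 2 < \<bar>b\<bar> \<longleftrightarrow> 1 / 2 < b\<^sup>2"
proof -
  have s: "\<bar>1 / sqrt 2\<bar> = 1 / sqrt 2" "(1 / sqrt 2)\<^sup>2 = 1 / 2"
    by (simp_all add: power_divide)
  show "\<bar>b\<bar> < 1 / sqrt 2 \<longleftrightarrow> b\<^sup>2 < 1 / 2" "1 / sqrt 2 < \<bar>b\<bar> \<longleftrightarrow> 1 / 2 < b\<^sup>2"
    using abs_le_square_iff[of b "1 / sqrt 2"] abs_le_square_iff[of "1 / sqrt 2" b]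
    unfolding s by linarith+
qed

theorem proposition7p12:
  fixes b :: real
  assumes "\<bar>b\<bar> \<notin> {0, 1}"
  shows "smooth_curve (Sigma_curve b) \<and> compact (Sigma_curve b) \<and>
    (0 < \<bar>b\<bar> \<and> \<bar>b\<bar> < 1 / sqrt 2 \<or> \<bar>b\<bar> > 1 \<longrightarrow>
       (\<forall>\<theta>\<in>Sigma_curve b. D_omega (S_fun b) \<theta> \<noteq> 0)) \<and>
    (1 / sqrt 2 < \<bar>b\<bar> \<and> \<bar>b\<bar> < 1 \<longrightarrow>
       (\<exists>\<theta>. tangency b \<theta>) \<and> (\<forall>\<theta>. tangency b \<theta> \<longrightarrow> tangency_of_order b 2 \<theta>)) \<and>
    (\<bar>b\<bar> = 1 / sqrt 2 \<longrightarrow>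
       (\<exists>\<theta>. tangency b \<theta>) \<and> (\<forall>\<theta>. tangency b \<theta> \<longrightarrow> tangency_of_order b 3 \<theta>))"
proof (intro conjI impI)
  show "smooth_curve (Sigma_curve b)"
    using assms by (intro smooth_curve_Sigma_curve) auto
  show "compact (Sigma_curve b)"
    by (rule compact_Sigma_curve)
next
  assume "0 < \<bar>b\<bar> \<and> \<bar>b\<bar> < 1 / sqrt 2 \<or> \<bar>b\<bar> > 1"
  then have "b\<^sup>2 < 1 / 2 \<or> \<not> b\<^sup>2 \<le> 1"
    using abs_compare_inv_sqrt_2(1) abs_square_le_1[of b] by auto
  then show "\<forall>\<theta>\<in>Sigma_curve b. D_omega (S_fun b) \<theta> \<noteq> 0"
    using tangency_imp_bounds[of b] unfolding tangency_def by force
next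
  assume "1 / sqrt 2 < \<bar>b\<bar> \<and> \<bar>b\<bar> < 1"
  then have b: "1 / 2 < b\<^sup>2" "b\<^sup>2 \<le> 1"
    using abs_compare_inv_sqrt_2(2) abs_square_le_1[of b] by auto
  then show "\<exists>\<theta>. tangency b \<theta>" by (intro ex_tangency) auto
  show "\<forall>\<theta>. tangency b \<theta> \<longrightarrow> tangency_of_order b 2 \<theta>"
    using b(1) by (auto intro: tangency_order_two)
next
  assume "\<bar>b\<bar> = 1 / sqrt 2"
  \<comment> \<open>Both strict comparisons fail, which leaves equality of the squares.\<close>
  then have b: "b\<^sup>2 = 1 / 2"
    using abs_compare_inv_sqrt_2[of b] by force
  then show "\<exists>\<theta>. tangency b \<theta>" by (intro ex_tangency) auto
  show "\<forall>\<theta>. tangency b \<theta> \<longrightarrow> tangency_of_order b 3 \<theta>"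
    using b by (auto intro: tangency_order_three)
qed

end
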